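(* Let $$v=\Big(\sum a^v_{ijk}y^is^jz^k,\ \sum b^v_{ijk}z^it^jx^k,\ \sum c^v_{ijk}x^iu^jy^k\Big),\qquad w=\Big(\sum a^w_{ijk}y^is^jz^k,\ \sum b^w_{ijk}z^it^jx^k,\ \sum c^w_{ijk}x^iu^jy^k\Big)$$ be elements of $K$ (all sums over $(i,j,k)\in\mathbb Z^3$, finitely many nonzero coefficients). Suppose $v$ and $w$ represent the same element of $\widetilde K$. Then for each $a^v_{ijk}$ there exists an $a^w_{lmp}$ such that $a^v_{ijk}=a^w_{lmp}$, $i=l$, $k=p$ and $$j\equiv m \mod \gcd(i,k).$$
   Context: $[a,b]=aba^{-1}b^{-1}$. $\Gamma_x=\langle y,z,s\mid [y,s],[z,s],[y,z]s^{-1}\rangle$, $\Gamma_y=\langle z,x,t\mid [z,t],[x,t],[z,x]t^{-1}\rangle$, $\Gamma_z=\langle x,y,u\mid [x,u],[y,u],[x,y]u^{-1}\rangle$, and $K=\mathbb Z\Gamma_x\times\mathbb Z\Gamma_y\times\mathbb Z\Gamma_z$ (product of integral group rings). Every element of $\Gamma_x$ (resp. $\Gamma_y$, $\Gamma_z$) is uniquely of the form $y^is^jz^k$ (resp. $z^it^jx^k$, $x^iu^jy^k$), so every element of $K$ is uniquely a triple of finite sums as in the claim. The group $\mathbb Z^6$ acts on $K$ by letting $(a,b,c,d,e,f)$ send $\left(\sum a_{ijk}y^is^jz^k,\sum b_{ijk}z^it^jx^k,\sum c_{ijk}x^iu^jy^k\right)$ to $\left(\sum a_{ijk}y^is^{j+(b-c)i+(f-a)k}z^k,\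 \sum b_{ijk}z^it^{j+(d-e)i+(b-c)k}x^k,\ \sum c_{ijk}x^iu^{j+(f-a)i+(d-e)k}y^k\right)$. $\widetilde K$ is the orbit space of this action. Convention: $\gcd(0,0)=0$, and congruence modulo $0$ means equality. *)

theory Defs
  imports "HOL-Algebra.Algebra" "HOL-Number_Theory.Cong" "HOL-Library.Poly_Mapping"
begin

section \<open>Groups given by generators and relators\<close>

text \<open>
  A word is a list of letters; the letter \<open>(x, True)\<close> stands for the generator \<open>x\<close>
  and \<open>(x, False)\<close> for its inverse.
\<close>

type_synonym 'a word = "('a \<times> bool) list"

definition words :: "'a set \<Rightarrow> 'a word set"
  where "words S = lists (S \<times> UNIV)"

definition word_inv :: "'a word \<Rightarrow> 'a word"
  where "word_inv w = rev (map (\<lambda>(x, e). (x, \<not> e)) w)"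

definition word_comm :: "'a word \<Rightarrow> 'a word \<Rightarrow> 'a word"
  where "word_comm u v = u @ v @ word_inv u @ word_inv v"

inductive_set pres_rel :: "'a set \<Rightarrow> 'a word set \<Rightarrow> ('a word \<times> 'a word) set"
  for S :: "'a set" and R :: "'a word set"
where
  refl: "w \<in> words S \<Longrightarrow> (w, w) \<in> pres_rel S R"
| sym: "(u, v) \<in> pres_rel S R \<Longrightarrow> (v, u) \<in> pres_rel S R"
| trans: "(u, v) \<in> pres_rel S R \<Longrightarrow> (v, w) \<in> pres_rel S R \<Longrightarrow> (u, w) \<in> pres_rel S R"
| cancel: "u \<in> words S \<Longrightarrow> v \<in> words S \<Longrightarrow> x \<in> S \<Longrightarrow>
    (u @ [(x, e), (x, \<not> e)] @ v, u @ v) \<in> pres_rel S R"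
| relator: "u \<in> words S \<Longrightarrow> v \<in> words S \<Longrightarrow> r \<in> R \<inter> words S \<Longrightarrow>
    (u @ r @ v, u @ v) \<in> pres_rel S R"

definition presented_group :: "'a set \<Rightarrow> 'a word set \<Rightarrow> 'a word set monoid"
  where "presented_group S R =
    \<lparr>carrier = words S // pres_rel S R,
     monoid.mult = (\<lambda>A B. \<Union>u\<in>A. \<Union>v\<in>B. pres_rel S R `` {u @ v}),
     one = pres_rel S R `` {[]}\<rparr>"

definition pres_gen :: "'a set \<Rightarrow> 'a word set \<Rightarrow> 'a \<Rightarrow> 'a word set"
  where "pres_gen S R x = pres_rel S R `` {[(x, True)]}"

section \<open>Integral group rings\<close>

text \<open>
  Elements of the group ring are finitely supported functions \<open>'g \<Rightarrow>\<^sub>0 int\<close> with support in the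
  carrier; \<open>frag_of g\<close> is the basis element \<open>g\<close>, and the product is the bilinear
  extension of the product of the group.
\<close>

definition group_ring :: "('g, 'm) monoid_scheme \<Rightarrow> ('g \<Rightarrow>\<^sub>0 int) ring"
  where "group_ring G =
    \<lparr>carrier = {v. Poly_Mapping.keys v \<subseteq> carrier G},
     monoid.mult = (\<lambda>v w. frag_extend (\<lambda>g. frag_extend (\<lambda>h. frag_of (g \<otimes>\<^bsub>G\<^esub> h)) w) v),
     one = frag_of \<one>\<^bsub>G\<^esub>,
     ring.zero = 0,
     ring.add = (+)\<rparr>"

section \<open>The three groups and the ring K\<close>

datatype gen = GX | GY | GZ | GS | GT | GU

abbreviation g1 :: "gen \<Rightarrow> gen word" where "g1 x \<equiv> [(x, True)]"

text \<open>
  The presentations of all three groups have the shape \<open>\<langle>p, q, r | [p,r], [q,r], [p,q] r\<inverse>\<rangle>\<close>, with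
  \<open>(p, q, r)\<close> equal to \<open>(y, z, s)\<close>, \<open>(z, x, t)\<close> and \<open>(x, y, u)\<close> respectively.
\<close>

definition Gens :: "gen \<Rightarrow> gen \<Rightarrow> gen \<Rightarrow> gen set"
  where "Gens p q r = {p, q, r}"

definition Rels :: "gen \<Rightarrow> gen \<Rightarrow> gen \<Rightarrow> gen word set"
  where "Rels p q r = {word_comm (g1 p) (g1 r), word_comm (g1 q) (g1 r),
    word_comm (g1 p) (g1 q) @ word_inv (g1 r)}"

definition Gam :: "gen \<Rightarrow> gen \<Rightarrow> gen \<Rightarrow> gen word set monoid"
  where "Gam p q r = presented_group (Gens p q r) (Rels p q r)"

definition Gam_gen :: "gen \<Rightarrow> gen \<Rightarrow> gen \<Rightarrow> gen \<Rightarrow> gen word set"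
  where "Gam_gen p q r = pres_gen (Gens p q r) (Rels p q r)"

text \<open>The element \<open>p\<^sup>i r\<^sup>j q\<^sup>k\<close>; note the order of the exponents.\<close>

definition nform :: "gen \<Rightarrow> gen \<Rightarrow> gen \<Rightarrow> int \<times> int \<times> int \<Rightarrow> gen word set"
  where "nform p q r = (\<lambda>(i, j, k).
    Gam_gen p q r p [^]\<^bsub>Gam p q r\<^esub> i \<otimes>\<^bsub>Gam p q r\<^esub>
    Gam_gen p q r r [^]\<^bsub>Gam p q r\<^esub> j \<otimes>\<^bsub>Gam p q r\<^esub>
    Gam_gen p q r q [^]\<^bsub>Gam p q r\<^esub> k)"

abbreviation Gam_x where "Gam_x \<equiv> Gam GY GZ GS"
abbreviation Gam_y where "Gam_y \<equiv> Gam GZ GX GT"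
abbreviation Gam_z where "Gam_z \<equiv> Gam GX GY GU"

abbreviation K_ring :: "((gen word set \<Rightarrow>\<^sub>0 int) \<times> (gen word set \<Rightarrow>\<^sub>0 int) \<times> (gen word set \<Rightarrow>\<^sub>0 int)) ring"
  where "K_ring \<equiv> RDirProd (group_ring Gam_x) (RDirProd (group_ring Gam_y) (group_ring Gam_z))"

text \<open>
  For a coefficient family \<open>c\<close>, the element \<open>\<Sum> c\<^sub>i\<^sub>j\<^sub>k p\<^sup>i r\<^sup>j q\<^sup>k\<close> of the group ring.
\<close>

definition nsum :: "gen \<Rightarrow> gen \<Rightarrow> gen \<Rightarrow> (int \<times> int \<times> int \<Rightarrow>\<^sub>0 int) \<Rightarrow> (gen word set \<Rightarrow>\<^sub>0 int)"
  where "nsum p q r c = frag_extend (\<lambda>t. frag_of (nform p q r t)) c"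

definition K_elem ::
  "(int \<times> int \<times> int \<Rightarrow>\<^sub>0 int) \<Rightarrow> (int \<times> int \<times> int \<Rightarrow>\<^sub>0 int) \<Rightarrow> (int \<times> int \<times> int \<Rightarrow>\<^sub>0 int) \<Rightarrow>
   (gen word set \<Rightarrow>\<^sub>0 int) \<times> (gen word set \<Rightarrow>\<^sub>0 int) \<times> (gen word set \<Rightarrow>\<^sub>0 int)"
  where "K_elem a b c = (nsum GY GZ GS a, nsum GZ GX GT b, nsum GX GY GU c)"

section \<open>The action of \<open>\<int>\<^sup>6\<close> and the orbit space\<close>

text \<open>
  \<open>\<Sum> c\<^sub>i\<^sub>j\<^sub>k p\<^sup>i r\<^sup>j q\<^sup>k\<close> is sent to \<open>\<Sum> c\<^sub>i\<^sub>j\<^sub>k p\<^sup>i r\<^bsup>j + m i + n k\<^esup> q\<^sup>k\<close>. The description is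
  unambiguous by \<open>nsum_bij\<close> below.
\<close>

definition twist :: "gen \<Rightarrow> gen \<Rightarrow> gen \<Rightarrow> int \<Rightarrow> int \<Rightarrow> (gen word set \<Rightarrow>\<^sub>0 int) \<Rightarrow> (gen word set \<Rightarrow>\<^sub>0 int)"
  where "twist p q r m n v = (THE w. \<exists>c. v = nsum p q r c \<and>
    w = frag_extend (\<lambda>(i, j, k). frag_of (nform p q r (i, j + m * i + n * k, k))) c)"

abbreviation Z6 :: "(int \<times> int \<times> int \<times> int \<times> int \<times> int) monoid"
  where "Z6 \<equiv> integer_group \<times>\<times> integer_group \<times>\<times> integer_group \<times>\<times>
              integer_group \<times>\<times> integer_group \<times>\<times> integer_group"

definition K_act :: "int \<times> int \<times> int \<times> int \<times> int \<times> int \<Rightarrow>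
   (gen word set \<Rightarrow>\<^sub>0 int) \<times> (gen word set \<Rightarrow>\<^sub>0 int) \<times> (gen word set \<Rightarrow>\<^sub>0 int) \<Rightarrow>
   (gen word set \<Rightarrow>\<^sub>0 int) \<times> (gen word set \<Rightarrow>\<^sub>0 int) \<times> (gen word set \<Rightarrow>\<^sub>0 int)"
  where "K_act = (\<lambda>(a, b, c, d, e, f). \<lambda>(u, v, w) \<in> carrier K_ring.
    (twist GY GZ GS (b - c) (f - a) u, twist GZ GX GT (d - e) (b - c) v, twist GX GY GU (f - a) (d - e) w))"

definition K_tilde :: "((gen word set \<Rightarrow>\<^sub>0 int) \<times> (gen word set \<Rightarrow>\<^sub>0 int) \<times> (gen word set \<Rightarrow>\<^sub>0 int)) set set"
  where "K_tilde = orbits Z6 (carrier K_ring) K_act"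


section \<open>Normal forms and the group action\<close>

lemma words_append [simp]: "u @ v \<in> words A \<longleftrightarrow> u \<in> words A \<and> v \<in> words A"
  by (auto simp: words_def)

lemma words_Nil [simp]: "[] \<in> words A"
  by (auto simp: words_def)

lemma words_Cons [simp]: "l # v \<in> words A \<longleftrightarrow> fst l \<in> A \<and> v \<in> words A"
  by (cases l) (auto simp: words_def)

lemma word_inv_Nil [simp]: "word_inv [] = []"
  by (simp add: word_inv_def)

lemma word_inv_Cons [simp]: "word_inv ((x, e) # w) = word_inv w @ [(x, \<not> e)]"
  by (simp add: word_inv_def)

lemma words_inv [simp]: "word_inv w \<in> words A \<longleftrightarrow> w \<in> words A"
  by (induction w) (auto simp: word_inv_def)

lemma word_inv_inv [simp]: "word_inv (word_inv w) = w"
  by (simp add: word_inv_def rev_map o_def split_def)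

lemma pres_rel_words: "(u, v) \<in> pres_rel A R \<Longrightarrow> u \<in> words A \<and> v \<in> words A"
  by (induction rule: pres_rel.induct) auto

lemma equiv_pres_rel: "equiv (words A) (pres_rel A R)"
proof (rule equivI)
  show "pres_rel A R \<subseteq> words A \<times> words A" using pres_rel_words by auto
  show "refl_on (words A) (pres_rel A R)" by (auto simp: refl_on_def intro: pres_rel.refl)
  show "Relation.sym (pres_rel A R)" by (auto simp: sym_def intro: pres_rel.sym)
  show "Relation.trans (pres_rel A R)" by (auto simp: trans_def intro: pres_rel.trans)
qed

lemma pres_rel_append_left:
  assumes "(u, v) \<in> pres_rel A R" "w \<in> words A"
  shows "(w @ u, w @ v) \<in> pres_rel A R"
  using assms
proof (induction rule: pres_rel.induct)
  case (cancel u v x e)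
  then show ?case using pres_rel.cancel[of "w @ u" A v x e R] by simp
next
  case (relator u v r)
  then show ?case using pres_rel.relator[of "w @ u" A v r R] by simp
qed (auto intro: pres_rel.intros)

lemma pres_rel_append_right:
  assumes "(u, v) \<in> pres_rel A R" "w \<in> words A"
  shows "(u @ w, v @ w) \<in> pres_rel A R"
  using assms
proof (induction rule: pres_rel.induct)
  case (cancel u v x e)
  then show ?case using pres_rel.cancel[of u A "v @ w" x e R] by simp
next
  case (relator u v r)
  then show ?case using pres_rel.relator[of u A "v @ w" r R] by simp
qed (auto intro: pres_rel.intros)

lemma pres_rel_append:
  assumes "(u, u') \<in> pres_rel A R" "(v, v') \<in> pres_rel A R"
  shows "(u @ v, u' @ v') \<in> pres_rel A R"
proof (rule pres_rel.trans)
  show "(u @ v, u' @ v) \<in> pres_rel A R"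
    using assms pres_rel_words by (blast intro: pres_rel_append_right)
  show "(u' @ v, u' @ v') \<in> pres_rel A R"
    using assms pres_rel_words by (blast intro: pres_rel_append_left)
qed

abbreviation pcls :: "'a set \<Rightarrow> 'a word set \<Rightarrow> 'a word \<Rightarrow> 'a word set"
  where "pcls A R w \<equiv> pres_rel A R `` {w}"

lemma pcls_eq: "(u, v) \<in> pres_rel A R \<Longrightarrow> pcls A R u = pcls A R v"
  using equiv_pres_rel by (rule equiv_class_eq)

lemma pcls_eq_iff: "u \<in> words A \<Longrightarrow> v \<in> words A \<Longrightarrow>
    pcls A R u = pcls A R v \<longleftrightarrow> (u, v) \<in> pres_rel A R"
  using equiv_pres_rel by (metis eq_equiv_class_iff)

lemma carrier_presented: "carrier (presented_group A R) = pcls A R ` words A"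
  unfolding presented_group_def quotient_def partial_object.select_convs by blast

lemma one_presented: "\<one>\<^bsub>presented_group A R\<^esub> = pcls A R []"
  by (simp add: presented_group_def)

lemma mult_presented:
  assumes "u \<in> words A" "v \<in> words A"
  shows "pcls A R u \<otimes>\<^bsub>presented_group A R\<^esub> pcls A R v = pcls A R (u @ v)"
proof -
  have eq: "pcls A R (u' @ v') = pcls A R (u @ v)"
    if "u' \<in> pcls A R u" "v' \<in> pcls A R v" for u' v'
    using that by (intro pcls_eq pres_rel_append) (simp_all add: pres_rel.sym)
  have mem: "u \<in> pcls A R u" "v \<in> pcls A R v"
    using assms by (simp_all add: pres_rel.refl)
  have "(\<Union>u'\<in>pcls A R u. \<Union>v'\<in>pcls A R v. pcls A R (u' @ v')) =
      (\<Union>u'\<in>pcls A R u. \<Union>v'\<in>pcls A R v. pcls A R (u @ v))"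
    by (intro SUP_cong HOL.refl eq)
  also have "\<dots> = pcls A R (u @ v)"
    using mem by blast
  finally show ?thesis by (simp only: presented_group_def monoid.select_convs)
qed

lemma presented_closed: "w \<in> words A \<Longrightarrow> pcls A R w \<in> carrier (presented_group A R)"
  by (simp add: carrier_presented)

lemma presented_cases:
  assumes "a \<in> carrier (presented_group A R)"
  obtains w where "w \<in> words A" "a = pcls A R w"
  using assms unfolding carrier_presented by (rule imageE)

lemma pres_rel_inv_left:
  assumes "w \<in> words A" shows "(word_inv w @ w, []) \<in> pres_rel A R"
  using assms
proof (induction w)
  case Nil
  then show ?case by (auto intro: pres_rel.refl)
next
  case (Cons l w)
  obtain x e where l: "l = (x, e)" by (cases l)
  have "(word_inv w @ [(x, \<not> e), (x, \<not> \<not> e)] @ w, word_inv w @ w) \<in> pres_rel A R"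
    using Cons.prems l by (intro pres_rel.cancel) auto
  then show ?case using Cons l by (auto intro: pres_rel.trans)
qed

lemma group_presented: "group (presented_group A R)" (is "group ?H")
proof (rule groupI)
  fix a b c assume "a \<in> carrier ?H" "b \<in> carrier ?H" "c \<in> carrier ?H"
  then obtain u v w where w: "u \<in> words A" "v \<in> words A" "w \<in> words A"
      "a = pcls A R u" "b = pcls A R v" "c = pcls A R w"
    by (metis presented_cases)
  have "a \<otimes>\<^bsub>?H\<^esub> b \<otimes>\<^bsub>?H\<^esub> c = pcls A R ((u @ v) @ w)"
    unfolding w(4-6) using w(1-3) by (simp only: mult_presented words_append)
  moreover have "a \<otimes>\<^bsub>?H\<^esub> (b \<otimes>\<^bsub>?H\<^esub> c) = pcls A R (u @ v @ w)"
    unfolding w(4-6) using w(1-3) by (simp only: mult_presented words_append)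
  ultimately show "a \<otimes>\<^bsub>?H\<^esub> b \<otimes>\<^bsub>?H\<^esub> c = a \<otimes>\<^bsub>?H\<^esub> (b \<otimes>\<^bsub>?H\<^esub> c)"
    by (simp only: append_assoc)
next
  fix a b assume "a \<in> carrier ?H" "b \<in> carrier ?H"
  then obtain u v where w: "u \<in> words A" "v \<in> words A" "a = pcls A R u" "b = pcls A R v"
    by (metis presented_cases)
  then show "a \<otimes>\<^bsub>?H\<^esub> b \<in> carrier ?H"
    by (simp only: mult_presented presented_closed words_append)
next
  show "\<one>\<^bsub>?H\<^esub> \<in> carrier ?H"
    unfolding one_presented by (rule presented_closed) simp
next
  fix a assume "a \<in> carrier ?H"
  then obtain w where w: "w \<in> words A" "a = pcls A R w" by (rule presented_cases)
  show "\<one>\<^bsub>?H\<^esub> \<otimes>\<^bsub>?H\<^esub> a = a"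
    unfolding one_presented w(2) using w(1) by (simp only: mult_presented words_Nil append_Nil)
  have "pcls A R (word_inv w) \<otimes>\<^bsub>?H\<^esub> a = \<one>\<^bsub>?H\<^esub>"
    unfolding one_presented w(2) using w(1) pcls_eq[OF pres_rel_inv_left[OF w(1)]]
    by (simp only: mult_presented words_inv)
  moreover have "pcls A R (word_inv w) \<in> carrier ?H"
    using w(1) by (simp only: presented_closed words_inv)
  ultimately show "\<exists>b \<in> carrier ?H. b \<otimes>\<^bsub>?H\<^esub> a = \<one>\<^bsub>?H\<^esub>"
    by blast
qed

text \<open>The Heisenberg group on \<open>\<int>\<^sup>3\<close>, used to separate the normal forms.\<close>

definition hmul :: "int \<times> int \<times> int \<Rightarrow> int \<times> int \<times> int \<Rightarrow> int \<times> int \<times> int"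
  where "hmul = (\<lambda>(i, j, k) (i', j', k'). (i + i', j + j' - k * i', k + k'))"

definition hlet :: "gen \<Rightarrow> gen \<Rightarrow> gen \<times> bool \<Rightarrow> int \<times> int \<times> int"
  where "hlet p q = (\<lambda>(x, e). let s = (if e then 1 else - 1) in
     if x = p then (s, 0, 0) else if x = q then (0, 0, s) else (0, s, 0))"

definition hev :: "gen \<Rightarrow> gen \<Rightarrow> gen word \<Rightarrow> int \<times> int \<times> int"
  where "hev p q w = foldr (\<lambda>l. hmul (hlet p q l)) w (0, 0, 0)"

lemma hmul_assoc: "hmul (hmul a b) c = hmul a (hmul b c)"
  by (auto simp: hmul_def algebra_simps split: prod.splits)

lemma hmul_zero [simp]: "hmul (0, 0, 0) a = a" "hmul a (0, 0, 0) = a"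
  by (auto simp: hmul_def split: prod.splits)

lemma hev_Nil [simp]: "hev p q [] = (0, 0, 0)"
  by (simp add: hev_def)

lemma hev_Cons [simp]: "hev p q (l # w) = hmul (hlet p q l) (hev p q w)"
  by (simp add: hev_def)

lemma hev_append [simp]: "hev p q (u @ v) = hmul (hev p q u) (hev p q v)"
  by (induction u) (auto simp: hmul_assoc)

lemma hev_pres_rel:
  assumes "(u, v) \<in> pres_rel (Gens p q r) (Rels p q r)" "p \<noteq> q" "p \<noteq> r" "q \<noteq> r"
  shows "hev p q u = hev p q v"
  using assms
proof (induction rule: pres_rel.induct)
  case (cancel u v x e)
  have "hmul (hlet p q (x, e)) (hlet p q (x, \<not> e)) = (0, 0, 0)"
    by (auto simp: hlet_def hmul_def Let_def)
  then show ?case by (simp flip: hmul_assoc)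
next
  case (relator u v w)
  then have "hev p q w = (0, 0, 0)"
    by (auto simp: Rels_def word_comm_def hlet_def hmul_def Let_def)
  then show ?case by simp
qed auto

definition hval :: "gen \<Rightarrow> gen \<Rightarrow> gen word set \<Rightarrow> int \<times> int \<times> int"
  where "hval p q C = hev p q (SOME w. w \<in> C)"

definition hgroup :: "(int \<times> int \<times> int) monoid"
  where "hgroup = \<lparr>carrier = UNIV, monoid.mult = hmul, one = (0, 0, 0)\<rparr>"

lemma group_hgroup: "group hgroup"
proof (rule groupI)
  fix a assume "a \<in> carrier hgroup"
  obtain i j k where a: "a = (i, j, k)" by (cases a)
  have "(- i, - j - k * i, - k) \<otimes>\<^bsub>hgroup\<^esub> a = \<one>\<^bsub>hgroup\<^esub>"
    by (simp add: a hgroup_def hmul_def)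
  then show "\<exists>b \<in> carrier hgroup. b \<otimes>\<^bsub>hgroup\<^esub> a = \<one>\<^bsub>hgroup\<^esub>"
    by (intro bexI) (auto simp: hgroup_def)
qed (auto simp: hgroup_def hmul_assoc)

lemma hgroup_pow:
  assumes "\<And>m n. f (m + n) = hmul (f m) (f n)" and [simp]: "f 0 = (0, 0, 0)"
  shows "f 1 [^]\<^bsub>hgroup\<^esub> (n :: int) = f n"
proof -
  interpret group hgroup by (rule group_hgroup)
  have nat: "f 1 [^]\<^bsub>hgroup\<^esub> (m :: nat) = f (int m)" for m
  proof (induction m)
    case 0
    then show ?case by (simp add: hgroup_def)
  next
    case (Suc m)
    have "f (int m + 1) = hmul (f (int m)) (f 1)" by (rule assms)
    then show ?case using Suc by (simp add: hgroup_def add.commute)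
  qed
  have inv: "inv\<^bsub>hgroup\<^esub> (f m) = f (- m)" for m
    by (rule inv_equality) (simp_all add: hgroup_def flip: assms(1))
  show ?thesis
  proof (cases "n < 0")
    case True
    have "f 1 [^]\<^bsub>hgroup\<^esub> n = inv\<^bsub>hgroup\<^esub> (f 1 [^]\<^bsub>hgroup\<^esub> nat (- n))"
      using True by (simp only: int_pow_def2 if_True)
    also have "\<dots> = f (- int (nat (- n)))"
      by (simp only: nat inv)
    finally show ?thesis using True by simp
  next
    case False
    have "f 1 [^]\<^bsub>hgroup\<^esub> n = f 1 [^]\<^bsub>hgroup\<^esub> nat n"
      using False by (simp only: int_pow_def2 if_False)
    also have "\<dots> = f (int (nat n))"
      by (simp only: nat)
    finally show ?thesis using False by simp
  qed
qed

locale heis =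
  fixes p q r :: gen
  assumes distinct: "p \<noteq> q" "p \<noteq> r" "q \<noteq> r"
begin

abbreviation "G \<equiv> Gam p q r"
abbreviation "cls \<equiv> pcls (Gens p q r) (Rels p q r)"
abbreviation "W \<equiv> words (Gens p q r)"
abbreviation "P \<equiv> Gam_gen p q r p"
abbreviation "Q \<equiv> Gam_gen p q r q"
abbreviation "C \<equiv> Gam_gen p q r r"

sublocale group G
  unfolding Gam_def by (rule group_presented)

lemma carrier_G: "carrier G = cls ` W"
  by (simp add: Gam_def carrier_presented)

lemma one_G: "\<one>\<^bsub>G\<^esub> = cls []"
  by (simp add: Gam_def one_presented)

lemma mult_G: "u \<in> W \<Longrightarrow> v \<in> W \<Longrightarrow> cls u \<otimes>\<^bsub>G\<^esub> cls v = cls (u @ v)"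
  by (simp add: Gam_def mult_presented)

lemma gen_cls: "P = cls (g1 p)" "Q = cls (g1 q)" "C = cls (g1 r)"
  by (simp_all add: Gam_gen_def pres_gen_def)

lemma cls_closed: "u \<in> W \<Longrightarrow> cls u \<in> carrier G"
  by (simp add: carrier_G)

lemma cls_cases:
  assumes "a \<in> carrier G" obtains w where "w \<in> W" "a = cls w"
  using assms unfolding carrier_G by (rule imageE)

lemma gens_W: "g1 p \<in> W" "g1 q \<in> W" "g1 r \<in> W"
  by (simp_all add: Gens_def)

lemma gen_closed [simp]: "P \<in> carrier G" "Q \<in> carrier G" "C \<in> carrier G"
  unfolding gen_cls using gens_W by (simp_all only: cls_closed)

lemma inv_cls: "u \<in> W \<Longrightarrow> inv\<^bsub>G\<^esub> (cls u) = cls (word_inv u)"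
  by (rule inv_equality) (simp_all add: mult_G one_G cls_closed pcls_eq pres_rel_inv_left)

lemma hval_cls: "w \<in> W \<Longrightarrow> hval p q (cls w) = hev p q w"
proof -
  assume "w \<in> W"
  then have "w \<in> cls w" by (auto intro: pres_rel.refl)
  then have "(SOME w'. w' \<in> cls w) \<in> cls w" by (rule someI)
  then show ?thesis
    using hev_pres_rel distinct unfolding hval_def by (metis Image_singleton_iff)
qed

lemma hval_hom: "group_hom G hgroup (hval p q)"
proof (rule group_hom.intro[OF is_group group_hgroup], unfold_locales, rule homI)
  fix a b assume "a \<in> carrier G" "b \<in> carrier G"
  then obtain u v where "u \<in> W" "v \<in> W" "a = cls u" "b = cls v" by (metis cls_cases)
  then show "hval p q (a \<otimes>\<^bsub>G\<^esub> b) = hval p q a \<otimes>\<^bsub>hgroup\<^esub> hval p q b"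
    by (simp add: mult_G hval_cls hgroup_def)
qed (auto simp: hgroup_def)

lemma hval_nform: "hval p q (nform p q r t) = t"
proof -
  interpret h: group_hom G hgroup "hval p q" by (rule hval_hom)
  obtain i j k where t: "t = (i, j, k)" by (cases t)
  have "hval p q P = (1, 0, 0)" "hval p q C = (0, 1, 0)" "hval p q Q = (0, 0, 1)"
    using distinct gens_W unfolding gen_cls by (simp_all only: hval_cls) (simp_all add: hlet_def)
  moreover have "(1, 0, 0) [^]\<^bsub>hgroup\<^esub> i = (i, 0, 0)"
    by (rule hgroup_pow[of "\<lambda>i. (i, 0, 0)"]) (auto simp: hmul_def)
  moreover have "(0, 1, 0) [^]\<^bsub>hgroup\<^esub> j = (0, j, 0)"
    by (rule hgroup_pow[of "\<lambda>i. (0, i, 0)"]) (auto simp: hmul_def)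
  moreover have "(0, 0, 1) [^]\<^bsub>hgroup\<^esub> k = (0, 0, k)"
    by (rule hgroup_pow[of "\<lambda>i. (0, 0, i)"]) (auto simp: hmul_def)
  ultimately show ?thesis
    by (simp add: t nform_def h.hom_int_pow) (simp add: hgroup_def hmul_def)
qed

lemma nform_closed [simp]: "nform p q r t \<in> carrier G"
  by (auto simp: nform_def split: prod.splits)

lemma relG:
  assumes "w \<in> Rels p q r" shows "cls w = \<one>\<^bsub>G\<^esub>"
proof -
  have "w \<in> W" using assms by (auto simp: Rels_def Gens_def word_comm_def)
  then have "([] @ w @ [], [] @ []) \<in> pres_rel (Gens p q r) (Rels p q r)"
    using assms by (intro pres_rel.relator) auto
  then show ?thesis by (simp add: one_G pcls_eq)
qed

lemma cls_comm: "u \<in> W \<Longrightarrow> v \<in> W \<Longrightarrow>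
    cls (word_comm u v) = cls u \<otimes>\<^bsub>G\<^esub> cls v \<otimes>\<^bsub>G\<^esub> inv\<^bsub>G\<^esub> cls u \<otimes>\<^bsub>G\<^esub> inv\<^bsub>G\<^esub> cls v"
  by (simp add: inv_cls mult_G word_comm_def)

lemma cancel_inv [simp]:
  assumes "a \<in> carrier G" "b \<in> carrier G"
  shows "a \<otimes>\<^bsub>G\<^esub> (inv\<^bsub>G\<^esub> a \<otimes>\<^bsub>G\<^esub> b) = b" "inv\<^bsub>G\<^esub> a \<otimes>\<^bsub>G\<^esub> (a \<otimes>\<^bsub>G\<^esub> b) = b"
  using assms by (simp_all flip: m_assoc)

lemma comm_eq:
  assumes "a \<in> carrier G" "b \<in> carrier G"
    and "c = a \<otimes>\<^bsub>G\<^esub> b \<otimes>\<^bsub>G\<^esub> inv\<^bsub>G\<^esub> a \<otimes>\<^bsub>G\<^esub> inv\<^bsub>G\<^esub> b"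
  shows "a \<otimes>\<^bsub>G\<^esub> b = c \<otimes>\<^bsub>G\<^esub> (b \<otimes>\<^bsub>G\<^esub> a)"
  using assms by (simp add: m_assoc)

lemma PC: "P \<otimes>\<^bsub>G\<^esub> C = C \<otimes>\<^bsub>G\<^esub> P"
proof -
  have "\<one>\<^bsub>G\<^esub> = cls (word_comm (g1 p) (g1 r))"
    by (rule relG[symmetric]) (simp add: Rels_def)
  then have "P \<otimes>\<^bsub>G\<^esub> C = \<one>\<^bsub>G\<^esub> \<otimes>\<^bsub>G\<^esub> (C \<otimes>\<^bsub>G\<^esub> P)"
    using gens_W by (intro comm_eq) (simp_all add: cls_comm gen_cls cls_closed)
  then show ?thesis by simp
qed

lemma QC: "Q \<otimes>\<^bsub>G\<^esub> C = C \<otimes>\<^bsub>G\<^esub> Q"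
proof -
  have "\<one>\<^bsub>G\<^esub> = cls (word_comm (g1 q) (g1 r))"
    by (rule relG[symmetric]) (simp add: Rels_def)
  then have "Q \<otimes>\<^bsub>G\<^esub> C = \<one>\<^bsub>G\<^esub> \<otimes>\<^bsub>G\<^esub> (C \<otimes>\<^bsub>G\<^esub> Q)"
    using gens_W by (intro comm_eq) (simp_all add: cls_comm gen_cls cls_closed)
  then show ?thesis by simp
qed

lemma PQ: "P \<otimes>\<^bsub>G\<^esub> Q = C \<otimes>\<^bsub>G\<^esub> (Q \<otimes>\<^bsub>G\<^esub> P)"
proof -
  let ?k = "word_comm (g1 p) (g1 q)"
  have W: "?k \<in> W" using gens_W by (simp add: word_comm_def)
  have "cls (?k @ word_inv (g1 r)) = \<one>\<^bsub>G\<^esub>"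
    by (rule relG) (simp add: Rels_def)
  moreover have "cls (?k @ word_inv (g1 r)) = cls ?k \<otimes>\<^bsub>G\<^esub> inv\<^bsub>G\<^esub> C"
    using W gens_W(3) unfolding gen_cls by (simp only: inv_cls mult_G words_inv)
  ultimately have "cls ?k \<otimes>\<^bsub>G\<^esub> inv\<^bsub>G\<^esub> C = \<one>\<^bsub>G\<^esub>" by simp
  then have "C = cls ?k"
    using W cls_closed gen_closed(3) inv_solve_right' l_one one_closed by metis
  then show ?thesis
    using gens_W by (intro comm_eq) (simp_all add: cls_comm gen_cls cls_closed)
qed

lemma conj_int_pow:
  assumes "a \<in> carrier G" "b \<in> carrier G"
  shows "(a \<otimes>\<^bsub>G\<^esub> b \<otimes>\<^bsub>G\<^esub> inv\<^bsub>G\<^esub> a) [^]\<^bsub>G\<^esub> (n :: int) = a \<otimes>\<^bsub>G\<^esub> b [^]\<^bsub>G\<^esub> n \<otimes>\<^bsub>G\<^esub> inv\<^bsub>G\<^esub> a"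
proof -
  have "group_hom G G (\<lambda>x. a \<otimes>\<^bsub>G\<^esub> x \<otimes>\<^bsub>G\<^esub> inv\<^bsub>G\<^esub> a)"
    using assms by unfold_locales (auto intro!: homI simp: m_assoc)
  from group_hom.hom_int_pow[OF this assms(2)] show ?thesis by simp
qed

lemma conj_eq:
  assumes "a \<in> carrier G" "b \<in> carrier G" "c \<in> carrier G"
    and "a \<otimes>\<^bsub>G\<^esub> b = c \<otimes>\<^bsub>G\<^esub> a"
  shows "a \<otimes>\<^bsub>G\<^esub> b [^]\<^bsub>G\<^esub> (n :: int) = c [^]\<^bsub>G\<^esub> n \<otimes>\<^bsub>G\<^esub> a"
proof -
  have "a \<otimes>\<^bsub>G\<^esub> b \<otimes>\<^bsub>G\<^esub> inv\<^bsub>G\<^esub> a = c"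
    using assms by (simp add: m_assoc)
  then have "c [^]\<^bsub>G\<^esub> n = a \<otimes>\<^bsub>G\<^esub> b [^]\<^bsub>G\<^esub> n \<otimes>\<^bsub>G\<^esub> inv\<^bsub>G\<^esub> a"
    using assms conj_int_pow by metis
  then show ?thesis using assms by (simp add: m_assoc)
qed

text \<open>Left multiplication of a normal form by a letter.\<close>

lemma C_nform: "C [^]\<^bsub>G\<^esub> (s :: int) \<otimes>\<^bsub>G\<^esub> nform p q r (i, j, k) = nform p q r (i, j + s, k)"
proof -
  have "C \<otimes>\<^bsub>G\<^esub> P [^]\<^bsub>G\<^esub> i = P [^]\<^bsub>G\<^esub> i \<otimes>\<^bsub>G\<^esub> C"
    by (rule conj_eq) (simp_all add: PC)
  then have *: "P [^]\<^bsub>G\<^esub> i \<otimes>\<^bsub>G\<^esub> C [^]\<^bsub>G\<^esub> s = C [^]\<^bsub>G\<^esub> s \<otimes>\<^bsub>G\<^esub> P [^]\<^bsub>G\<^esub> i"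
    by (intro conj_eq) simp_all
  have "C [^]\<^bsub>G\<^esub> s \<otimes>\<^bsub>G\<^esub> nform p q r (i, j, k) =
      (C [^]\<^bsub>G\<^esub> s \<otimes>\<^bsub>G\<^esub> P [^]\<^bsub>G\<^esub> i) \<otimes>\<^bsub>G\<^esub> (C [^]\<^bsub>G\<^esub> j \<otimes>\<^bsub>G\<^esub> Q [^]\<^bsub>G\<^esub> k)"
    by (simp add: nform_def m_assoc)
  also have "\<dots> = P [^]\<^bsub>G\<^esub> i \<otimes>\<^bsub>G\<^esub> (C [^]\<^bsub>G\<^esub> s \<otimes>\<^bsub>G\<^esub> C [^]\<^bsub>G\<^esub> j) \<otimes>\<^bsub>G\<^esub> Q [^]\<^bsub>G\<^esub> k"
    unfolding *[symmetric] by (simp add: m_assoc)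
  also have "\<dots> = nform p q r (i, j + s, k)"
    by (simp add: nform_def int_pow_mult[symmetric] add.commute)
  finally show ?thesis .
qed

lemma P_nform: "P [^]\<^bsub>G\<^esub> (s :: int) \<otimes>\<^bsub>G\<^esub> nform p q r (i, j, k) = nform p q r (s + i, j, k)"
  by (simp add: nform_def int_pow_mult m_assoc)

lemma Q_P: "Q \<otimes>\<^bsub>G\<^esub> P [^]\<^bsub>G\<^esub> (i :: int) = C [^]\<^bsub>G\<^esub> (- i) \<otimes>\<^bsub>G\<^esub> (P [^]\<^bsub>G\<^esub> i \<otimes>\<^bsub>G\<^esub> Q)"
proof -
  have "P [^]\<^bsub>G\<^esub> i \<otimes>\<^bsub>G\<^esub> Q = (C \<otimes>\<^bsub>G\<^esub> (Q \<otimes>\<^bsub>G\<^esub> P \<otimes>\<^bsub>G\<^esub> inv\<^bsub>G\<^esub> Q)) [^]\<^bsub>G\<^esub> i \<otimes>\<^bsub>G\<^esub> Q"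
  proof -
    have "P = P \<otimes>\<^bsub>G\<^esub> Q \<otimes>\<^bsub>G\<^esub> inv\<^bsub>G\<^esub> Q" by (simp add: m_assoc)
    also have "\<dots> = C \<otimes>\<^bsub>G\<^esub> (Q \<otimes>\<^bsub>G\<^esub> P \<otimes>\<^bsub>G\<^esub> inv\<^bsub>G\<^esub> Q)" unfolding PQ by (simp add: m_assoc)
    finally show ?thesis by simp
  qed
  also have "(C \<otimes>\<^bsub>G\<^esub> (Q \<otimes>\<^bsub>G\<^esub> P \<otimes>\<^bsub>G\<^esub> inv\<^bsub>G\<^esub> Q)) [^]\<^bsub>G\<^esub> i =
      C [^]\<^bsub>G\<^esub> i \<otimes>\<^bsub>G\<^esub> (Q \<otimes>\<^bsub>G\<^esub> P \<otimes>\<^bsub>G\<^esub> inv\<^bsub>G\<^esub> Q) [^]\<^bsub>G\<^esub> i"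
  proof (rule int_pow_mult_distrib)
    have CQ: "C \<otimes>\<^bsub>G\<^esub> inv\<^bsub>G\<^esub> Q = inv\<^bsub>G\<^esub> Q \<otimes>\<^bsub>G\<^esub> C"
      using conj_eq[of C Q Q "-1"] by (simp add: QC int_pow_neg)
    have "Q \<otimes>\<^bsub>G\<^esub> P \<otimes>\<^bsub>G\<^esub> inv\<^bsub>G\<^esub> Q \<otimes>\<^bsub>G\<^esub> C = Q \<otimes>\<^bsub>G\<^esub> (P \<otimes>\<^bsub>G\<^esub> C) \<otimes>\<^bsub>G\<^esub> inv\<^bsub>G\<^esub> Q"
      by (simp add: m_assoc CQ)
    also have "\<dots> = Q \<otimes>\<^bsub>G\<^esub> C \<otimes>\<^bsub>G\<^esub> P \<otimes>\<^bsub>G\<^esub> inv\<^bsub>G\<^esub> Q"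
      unfolding PC by (simp add: m_assoc)
    finally show "C \<otimes>\<^bsub>G\<^esub> (Q \<otimes>\<^bsub>G\<^esub> P \<otimes>\<^bsub>G\<^esub> inv\<^bsub>G\<^esub> Q) = Q \<otimes>\<^bsub>G\<^esub> P \<otimes>\<^bsub>G\<^esub> inv\<^bsub>G\<^esub> Q \<otimes>\<^bsub>G\<^esub> C"
      unfolding QC by (simp add: m_assoc)
  qed simp_all
  also have "\<dots> \<otimes>\<^bsub>G\<^esub> Q = C [^]\<^bsub>G\<^esub> i \<otimes>\<^bsub>G\<^esub> (Q \<otimes>\<^bsub>G\<^esub> P [^]\<^bsub>G\<^esub> i)"
    unfolding conj_int_pow[OF gen_closed(2,1)] by (simp add: m_assoc)
  finally show ?thesis by (simp add: int_pow_neg)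
qed

lemma Q_nform: "Q \<otimes>\<^bsub>G\<^esub> nform p q r (i, j, k) = nform p q r (i, j - i, k + 1)"
proof -
  have QCj: "Q \<otimes>\<^bsub>G\<^esub> C [^]\<^bsub>G\<^esub> j = C [^]\<^bsub>G\<^esub> j \<otimes>\<^bsub>G\<^esub> Q"
    by (rule conj_eq) (simp_all add: QC)
  have Qk: "Q [^]\<^bsub>G\<^esub> (k + 1) = Q \<otimes>\<^bsub>G\<^esub> Q [^]\<^bsub>G\<^esub> k"
    using int_pow_mult[of Q 1 k] by (simp add: add.commute)
  have "Q \<otimes>\<^bsub>G\<^esub> nform p q r (i, j, k) = (Q \<otimes>\<^bsub>G\<^esub> P [^]\<^bsub>G\<^esub> i) \<otimes>\<^bsub>G\<^esub> (C [^]\<^bsub>G\<^esub> j \<otimes>\<^bsub>G\<^esub> Q [^]\<^bsub>G\<^esub> k)"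
    by (simp add: nform_def m_assoc)
  also have "\<dots> = C [^]\<^bsub>G\<^esub> (- i) \<otimes>\<^bsub>G\<^esub> (P [^]\<^bsub>G\<^esub> i \<otimes>\<^bsub>G\<^esub> ((Q \<otimes>\<^bsub>G\<^esub> C [^]\<^bsub>G\<^esub> j) \<otimes>\<^bsub>G\<^esub> Q [^]\<^bsub>G\<^esub> k))"
    unfolding Q_P by (simp add: m_assoc)
  also have "\<dots> = C [^]\<^bsub>G\<^esub> (- i) \<otimes>\<^bsub>G\<^esub> nform p q r (i, j, k + 1)"
    unfolding QCj nform_def by (simp add: m_assoc Qk)
  finally show ?thesis by (simp add: C_nform)
qed

lemma Qinv_nform: "inv\<^bsub>G\<^esub> Q \<otimes>\<^bsub>G\<^esub> nform p q r (i, j, k) = nform p q r (i, j + i, k - 1)"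
  using Q_nform[of i "j + i" "k - 1"] cancel_inv(2)[of Q "nform p q r (i, j + i, k - 1)"] by simp

lemma cls_letter_nform:
  assumes "x \<in> Gens p q r"
  shows "cls [(x, e)] \<otimes>\<^bsub>G\<^esub> nform p q r t = nform p q r (hmul (hlet p q (x, e)) t)"
proof -
  obtain i j k where t: "t = (i, j, k)" by (cases t)
  have inv: "cls [(y, False)] = inv\<^bsub>G\<^esub> cls (g1 y)" if "y \<in> Gens p q r" for y
    using that inv_cls[of "g1 y"] by simp
  have x: "x = p \<or> x = q \<or> x = r" using assms by (auto simp: Gens_def)
  have pm: "a [^]\<^bsub>G\<^esub> (- 1 :: int) = inv\<^bsub>G\<^esub> a" if "a \<in> carrier G" for a
    using that by (simp add: int_pow_neg)
  have C1: "C \<otimes>\<^bsub>G\<^esub> nform p q r (i, j, k) = nform p q r (i, j + 1, k)"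
    "inv\<^bsub>G\<^esub> C \<otimes>\<^bsub>G\<^esub> nform p q r (i, j, k) = nform p q r (i, j - 1, k)"
    using C_nform[of 1 i j k] C_nform[of "- 1" i j k] by (simp_all add: pm)
  have P1: "P \<otimes>\<^bsub>G\<^esub> nform p q r (i, j, k) = nform p q r (1 + i, j, k)"
    "inv\<^bsub>G\<^esub> P \<otimes>\<^bsub>G\<^esub> nform p q r (i, j, k) = nform p q r (- 1 + i, j, k)"
    using P_nform[of 1 i j k] P_nform[of "- 1" i j k] by (simp_all add: pm)
  show ?thesis
    using x assms distinct
    by (cases e) (auto simp: t hlet_def hmul_def inv C1 P1 Q_nform Qinv_nform
        add.commute simp flip: gen_cls)
qed

lemma cls_nform: "w \<in> W \<Longrightarrow> cls w = nform p q r (hev p q w)"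
proof (induction w)
  case Nil
  then show ?case by (simp add: nform_def flip: one_G)
next
  case (Cons l w)
  obtain x e where l: "l = (x, e)" by (cases l)
  have "cls (l # w) = cls [(x, e)] \<otimes>\<^bsub>G\<^esub> cls w"
    using Cons.prems by (simp add: mult_G l)
  then show ?case
    using Cons by (simp add: l cls_letter_nform)
qed

lemma nform_bij: "bij_betw (nform p q r) UNIV (carrier G)"
proof (rule bij_betw_imageI)
  show "inj (nform p q r)" by (rule inj_on_inverseI) (rule hval_nform)
  show "range (nform p q r) = carrier G"
  proof
    show "range (nform p q r) \<subseteq> carrier G" by auto
    show "carrier G \<subseteq> range (nform p q r)"
    proof
      fix a assume "a \<in> carrier G"
      then obtain w where "w \<in> W" "a = cls w" by (rule cls_cases)
      then show "a \<in> range (nform p q r)" by (simp add: cls_nform)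
    qed
  qed
qed

lemma nsum_inverse: "frag_extend (frag_of \<circ> hval p q) (nsum p q r c) = c"
proof -
  have "frag_extend (frag_of \<circ> hval p q) (nsum p q r c) = frag_extend (frag_of \<circ> (hval p q \<circ> nform p q r)) c"
    unfolding nsum_def
    using frag_extend_compose[of "frag_of \<circ> hval p q" "nform p q r" c] by (simp add: o_def)
  also have "\<dots> = c"
    using frag_expansion[of c] by (simp add: o_def hval_nform)
  finally show ?thesis .
qed

lemma nsum_bij: "bij_betw (nsum p q r) UNIV (carrier (group_ring G))"
proof (rule bij_betw_imageI)
  show "inj (nsum p q r)" by (rule inj_on_inverseI) (rule nsum_inverse)
  show "range (nsum p q r) = carrier (group_ring G)"
  proof
    show "range (nsum p q r) \<subseteq> carrier (group_ring G)"
      using keys_frag_extend[of "\<lambda>t. frag_of (nform p q r t)"]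
      by (force simp: group_ring_def nsum_def)
    show "carrier (group_ring G) \<subseteq> range (nsum p q r)"
    proof
      fix v assume "v \<in> carrier (group_ring G)"
      then have v: "Poly_Mapping.keys v \<subseteq> carrier G" by (simp add: group_ring_def)
      have "nform p q r (hval p q g) = g" if "g \<in> carrier G" for g
      proof -
        from that obtain t where "g = nform p q r t"
          using nform_bij by (metis bij_betw_imp_surj_on imageE)
        then show ?thesis by (simp add: hval_nform)
      qed
      then have "frag_extend (frag_of \<circ> (nform p q r \<circ> hval p q)) v = frag_extend frag_of v"
        using v by (intro frag_extend_eq) auto
      then have "nsum p q r (frag_extend (frag_of \<circ> hval p q) v) = v"
        unfolding nsum_def
        using frag_extend_compose[of "\<lambda>t. frag_of (nform p q r t)" "hval p q" v] frag_expansion[of v]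
        by (simp add: o_def)
      then show "v \<in> range (nsum p q r)" by (metis rangeI)
    qed
  qed
qed

end

definition shear :: "int \<Rightarrow> int \<Rightarrow> int \<times> int \<times> int \<Rightarrow> int \<times> int \<times> int"
  where "shear m n = (\<lambda>(i, j, k). (i, j + m * i + n * k, k))"

definition shear_coeffs :: "int \<Rightarrow> int \<Rightarrow> (int \<times> int \<times> int \<Rightarrow>\<^sub>0 int) \<Rightarrow> (int \<times> int \<times> int \<Rightarrow>\<^sub>0 int)"
  where "shear_coeffs m n = frag_extend (frag_of \<circ> shear m n)"

lemma shear_coeffs_0: "shear_coeffs 0 0 c = c"
  using frag_expansion[of c] by (simp add: shear_coeffs_def shear_def o_def split_def)

lemma shear_coeffs_add: "shear_coeffs m n (shear_coeffs m' n' c) = shear_coeffs (m + m') (n + n') c"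
proof -
  have "shear m n \<circ> shear m' n' = shear (m + m') (n + n')"
    by (auto simp: shear_def algebra_simps)
  then show ?thesis
    unfolding shear_coeffs_def frag_extend_compose by (simp add: comp_assoc)
qed

lemma (in heis) twist_nsum: "twist p q r m n (nsum p q r c) = nsum p q r (shear_coeffs m n c)"
proof -
  have eq: "frag_extend (\<lambda>(i, j, k). frag_of (nform p q r (i, j + m * i + n * k, k))) c' =
      nsum p q r (shear_coeffs m n c')" for c'
    using frag_extend_compose[of "\<lambda>t. frag_of (nform p q r t)" "shear m n" c']
    by (simp add: nsum_def shear_coeffs_def shear_def o_def split_def)
  show ?thesis
    unfolding twist_def eq
    using nsum_bij by (intro the_equality) (auto simp: bij_betw_def dest: injD)
qed

interpretation Gx: heis GY GZ GS by unfold_locales simp_all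
interpretation Gy: heis GZ GX GT by unfold_locales simp_all
interpretation Gz: heis GX GY GU by unfold_locales simp_all

lemma K_elem_closed: "K_elem a b c \<in> carrier K_ring"
  using Gx.nsum_bij Gy.nsum_bij Gz.nsum_bij
  by (auto simp: K_elem_def RDirProd_carrier bij_betw_def)

lemma K_elem_cases:
  assumes "v \<in> carrier K_ring"
  obtains a b c where "v = K_elem a b c"
proof -
  obtain v1 v2 v3 where v: "v = (v1, v2, v3)" by (cases v)
  then have "v1 \<in> range (nsum GY GZ GS)" "v2 \<in> range (nsum GZ GX GT)" "v3 \<in> range (nsum GX GY GU)"
    using assms Gx.nsum_bij Gy.nsum_bij Gz.nsum_bij by (auto simp: RDirProd_carrier bij_betw_def)
  then show ?thesis using that v by (auto simp: K_elem_def)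
qed

lemma K_elem_inject: "K_elem a b c = K_elem a' b' c' \<longleftrightarrow> a = a' \<and> b = b' \<and> c = c'"
  using Gx.nsum_bij Gy.nsum_bij Gz.nsum_bij by (auto simp: K_elem_def bij_betw_def dest: injD)

lemma K_act_elem: "K_act (a, b, c, d, e, f) (K_elem u v w) =
    K_elem (shear_coeffs (b - c) (f - a) u) (shear_coeffs (d - e) (b - c) v) (shear_coeffs (f - a) (d - e) w)"
  using K_elem_closed[of u v w]
  by (simp add: K_act_def K_elem_def Gx.twist_nsum Gy.twist_nsum Gz.twist_nsum)

lemma K_act_closed: "v \<in> carrier K_ring \<Longrightarrow> K_act g v \<in> carrier K_ring"
  by (cases g, erule K_elem_cases) (simp add: K_act_elem K_elem_closed)

lemma K_act_mult:
  assumes "v \<in> carrier K_ring" shows "K_act (g \<otimes>\<^bsub>Z6\<^esub> h) v = K_act g (K_act h v)"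
proof -
  obtain a b c d e f where g: "g = (a, b, c, d, e, f)" by (cases g)
  obtain a' b' c' d' e' f' where h: "h = (a', b', c', d', e', f')" by (cases h)
  show ?thesis
    using assms by (elim K_elem_cases) (simp add: g h K_act_elem shear_coeffs_add algebra_simps)
qed

lemma K_act_0: "v \<in> carrier K_ring \<Longrightarrow> K_act (0, 0, 0, 0, 0, 0) v = v"
  by (erule K_elem_cases) (simp add: K_act_elem shear_coeffs_0)

lemma group_action_K_act: "group_action Z6 (carrier K_ring) K_act"
proof -
  interpret Z: group Z6 by (intro DirProd_group group_integer_group)
  have inv: "K_act g (K_act (inv\<^bsub>Z6\<^esub> g) v) = v" "K_act (inv\<^bsub>Z6\<^esub> g) (K_act g v) = v"
    if "v \<in> carrier K_ring" for g v
    using that K_act_mult[OF that, of g "inv\<^bsub>Z6\<^esub> g"] K_act_mult[OF that, of "inv\<^bsub>Z6\<^esub> g" g]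
      Z.r_inv[of g] Z.l_inv[of g] K_act_0[OF that] by auto
  have ext: "K_act g \<in> extensional (carrier K_ring)" for g
    by (cases g) (auto simp: K_act_def)
  have Bij: "K_act g \<in> Bij (carrier K_ring)" for g
  proof -
    have "bij_betw (K_act g) (carrier K_ring) (carrier K_ring)"
      by (rule bij_betw_byWitness[where f' = "K_act (inv\<^bsub>Z6\<^esub> g)"])
        (use inv K_act_closed in blast)+
    then show ?thesis using ext by (simp only: Bij_def Int_iff mem_Collect_eq)
  qed
  have "K_act \<in> hom Z6 (BijGroup (carrier K_ring))"
  proof (rule homI)
    show "K_act g \<in> carrier (BijGroup (carrier K_ring))" for g
      using Bij by (simp add: BijGroup_def)
    show "K_act (g \<otimes>\<^bsub>Z6\<^esub> h) = K_act g \<otimes>\<^bsub>BijGroup (carrier K_ring)\<^esub> K_act h" for g h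
    proof (rule extensionalityI[of _ "carrier K_ring"])
      show "K_act g \<otimes>\<^bsub>BijGroup (carrier K_ring)\<^esub> K_act h \<in> extensional (carrier K_ring)"
        using Bij by (simp add: BijGroup_def)
      show "K_act (g \<otimes>\<^bsub>Z6\<^esub> h) v = (K_act g \<otimes>\<^bsub>BijGroup (carrier K_ring)\<^esub> K_act h) v"
        if "v \<in> carrier K_ring" for v
        using Bij that by (simp add: BijGroup_def compose_def K_act_mult)
    qed (rule ext)
  qed
  then show ?thesis
    by (intro group_action.intro group_hom.intro group_hom_axioms.intro group_BijGroup Z.is_group)
qed

end

theory Submission
  imports Defs
begin

text \<open>
  The three normal-form families give coordinates on \<open>K\<close> in which an element of \<open>\<int>\<^sup>6\<close> permutes
  the exponent triples in each component by a shear \<open>(i, j, k) \<mapsto> (i, j + m i + n k, k)\<close>.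
  A shear is bijective, so it only moves coefficients around, and it displaces the middle exponent
  by an integer combination of \<open>i\<close> and \<open>k\<close>, hence by a multiple of \<open>gcd i k\<close>. If \<open>v\<close> and \<open>w\<close> lie in
  the orbit of \<open>x\<close>, then the first coefficient families of both are shears of that of \<open>x\<close>;
  following one coefficient back from \<open>v\<close> to \<open>x\<close> and forward to \<open>w\<close> keeps \<open>i\<close> and \<open>k\<close> fixed and
  changes \<open>j\<close> by two such displacements.
\<close>

lemma lookup_frag_extend_frag_of_inj:
  assumes "inj f"
  shows "Poly_Mapping.lookup (frag_extend (frag_of \<circ> f) c) (f t) = Poly_Mapping.lookup c t"
  by (rule frag_induction[of c UNIV])
    (use assms in \<open>auto simp: frag_extend_diff lookup_minus inj_eq lookup_single when_def\<close>)

text \<open>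
  Stated at the target triple, so that the right-hand side exhibits the triple of \<open>c\<close> from which
  the coefficient at \<open>(i, j, k)\<close> comes.
\<close>

lemma lookup_shear_coeffs:
  "Poly_Mapping.lookup (shear_coeffs m n c) (i, j, k) =
    Poly_Mapping.lookup c (i, j - m * i - n * k, k)"
proof -
  have "inj (shear m n)"
    by (auto simp: inj_def shear_def)
  from lookup_frag_extend_frag_of_inj[OF this, of c "(i, j - m * i - n * k, k)"]
  show ?thesis
    by (simp add: shear_coeffs_def shear_def)
qed

lemma K_tilde_common_shear:
  assumes "Q \<in> K_tilde" "K_elem av bv cv \<in> Q" "K_elem aw bw cw \<in> Q"
  obtains a m n m' n' where "av = shear_coeffs m n a" "aw = shear_coeffs m' n' a"
proof -
  obtain x where "x \<in> carrier K_ring" and Q: "Q = orbit Z6 K_act x"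
    using assms(1) by (auto simp: K_tilde_def orbits_def)
  then obtain a b c where x: "x = K_elem a b c"
    by (meson K_elem_cases)
  have shear: "\<exists>m n. a' = shear_coeffs m n a" if "K_elem a' b' c' \<in> Q" for a' b' c'
    using that by (auto simp: Q x orbit_def K_act_elem K_elem_inject)
  show ?thesis
    using shear[OF assms(2)] shear[OF assms(3)] that by blast
qed

theorem theorem1p3:
  fixes av bv cv aw bw cw :: "int \<times> int \<times> int \<Rightarrow>\<^sub>0 int"
  assumes "v = K_elem av bv cv" and "w = K_elem aw bw cw"
    and "Q \<in> K_tilde" and "v \<in> Q" and "w \<in> Q"
  shows "\<forall>i j k :: int. \<exists>l m p :: int. Poly_Mapping.lookup av (i, j, k) = Poly_Mapping.lookup aw (l, m, p) \<and> i = l \<and> k = p \<and>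
           [j = m] (mod gcd i k)"
proof (intro allI)
  fix i j k :: int
  obtain a m n m' n' where av: "av = shear_coeffs m n a" and aw: "aw = shear_coeffs m' n' a"
    using assms K_tilde_common_shear by metis
  \<comment> \<open>Undo the shear that leads to \<open>av\<close>, then apply the one that leads to \<open>aw\<close>.\<close>
  define j' where "j' = j - m * i - n * k + (m' * i + n' * k)"
  have "Poly_Mapping.lookup av (i, j, k) = Poly_Mapping.lookup aw (i, j', k)"
    by (simp add: av aw lookup_shear_coeffs j'_def algebra_simps)
  moreover have "[j = j'] (mod gcd i k)"
  proof -
    have "j - j' = (m - m') * i + (n - n') * k"
      by (simp add: j'_def algebra_simps)
    then show ?thesis
      by (simp add: cong_iff_dvd_diff)
  qed
  ultimately show "\<exists>l m p. Poly_Mapping.lookup av (i, j, k) = Poly_Mapping.lookup aw (l, m, p) \<and>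
      i = l \<and> k = p \<and> [j = m] (mod gcd i k)"
    by blast
qed

end
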